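(* Let $\mathbf{\Sigma}$ be a nice topological pointclass, and assume that $\mathsf{Det}(\mathbf{\Sigma}(\omega^\omega))$ holds. Let $Z$ be an uncountable zero-dimensional Polish space, let $1\leq\eta<\omega_1$, let $\mathbf{\Lambda}_n\in\mathsf{NSD}(Z)$ for $n\in\omega$ be such that each $\ell(\mathbf{\Lambda}_n)\geq 1$, and let $\mathbf{\Gamma}^\ast\in\mathsf{NSD}(Z)$ be such that $\mathbf{\Gamma}^\ast\subseteq\mathcal{D}$, where $\mathcal{D}=\bigcup_{n\in\omega}(\mathbf{\Lambda}_n\cup\check{\mathbf{\Lambda}}_n)$. Set $\mathbf{\Gamma}=\mathsf{SD}_\eta(\mathcal{D},\mathbf{\Gamma}^\ast)$, and assume that $\mathbf{\Gamma}\subseteq\mathbf{\Sigma}(Z)$. If $\mathbf{\Gamma}^\ast$ has the separation property then $\mathbf{\Gamma}$ has the separation property.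
   Context: Work in $\mathsf{ZF}+\mathsf{DC}$. "Space" means separable metrizable topological space. A space is zero-dimensional if it is non-empty and has a base of clopen sets. Determinacy: a set $S\subseteq\omega^\omega$ is determined if one of the players has a winning strategy in the game where I and II alternately play $x_0,y_0,x_1,y_1,\ldots\in\omega$ and I wins iff $(x_0,y_0,x_1,y_1,\ldots)\in S$. $\mathsf{Det}(\mathcal{S})$ means every element of $\mathcal{S}\subseteq\mathcal{P}(\omega^\omega)$ is determined. Pointclasses: a topological pointclass is a function $\mathbf{\Sigma}$ assigning to each space $Z$ a collection $\mathbf{\Sigma}(Z)\subseteq\mathcal{P}(Z)$ such that $f^{-1}[B]\in\mathbf{\Sigma}(Z)$ whenever $f:Z\to W$ is continuous and $B\in\mathbf{\Sigma}(W)$. A Borel space is a space homeomorphic to a Borel subset of a Polish space. $\mathbf{\Sigma}$ is nice if moreover, for every space $Z$: every Borel subset of $Z$ is in $\mathbf{\Sigma}(Z)$; $\mathbf{\Sigma}(Z)$ is a Boolean subalgebra of $\mathcal{P}(Z)$; $f^{-1}[B]\in\mathbf{\Sigma}(Z)$ whenever $f:Z\to W$ is a Borel function and $B\in\mathbf{\Sigma}(W)$; and if $j[Z]\in\mathbf{\Sigma}(W)$ for some Borel space $W$ and embedding $j:Z\to W$, then $i[Z]\in\mathbf{\Sigma}(W)$ for every Borel space $W$ and embedding $i:Z\to W$. Wadge classes: for $\mathbf{\Gamma}\subseteq\mathcal{P}(Z)$, the dual is $\check{\mathbf{\Gamma}}=\{Z\setminus A:A\in\mathbf{\Gamma}\}$;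 $\mathbf{\Gamma}$ is selfdual if $\mathbf{\Gamma}=\check{\mathbf{\Gamma}}$; $\Delta(\mathbf{\Gamma})=\mathbf{\Gamma}\cap\check{\mathbf{\Gamma}}$. A Wadge class in $Z$ is a collection of the form $\{f^{-1}[A]:f:Z\to Z\text{ continuous}\}$ for some $A\subseteq Z$. $\mathsf{NSD}(Z)$ is the set of all non-selfdual Wadge classes in $Z$. Level: $\ell(\mathbf{\Gamma})\geq 1$ means $\mathsf{PU}_1(\mathbf{\Gamma})=\mathbf{\Gamma}$, where $\mathsf{PU}_1(\mathbf{\Gamma})$ is the collection of all sets $\bigcup_{n\in\omega}(A_n\cap V_n)$ with $A_n\in\mathbf{\Gamma}$ and $V_n\in\mathbf{\Delta}^0_2(Z)$ pairwise disjoint with $\bigcup_n V_n=Z$. Separation: $\mathbf{\Gamma}\subseteq\mathcal{P}(Z)$ has the separation property if for all disjoint $A,B\in\mathbf{\Gamma}$ there is $C\in\Delta(\mathbf{\Gamma})$ with $A\subseteq C\subseteq Z\setminus B$. Separated differences: for $\mathcal{D},\mathbf{\Gamma}^\ast\subseteq\mathcal{P}(Z)$ and $1\leq\eta<\omega_1$, $\mathsf{SD}_\eta(\mathcal{D},\mathbf{\Gamma}^\ast)$ is the collection of all sets of the form $$\bigcup_{\mu<\eta,\,n\in\omega}\Big(A_{\mu,n}\cap U_{\mu,n}\setminus\bigcup_{\mu'<\mu,\,m\in\omega}U_{\mu',m}\Big)\cup\Big(A^\ast\setminus\bigcup_{\mu<\eta,\,n\in\omega}U_{\mu,n}\Big),$$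 where each $U_{\mu,n}$ is open in $Z$, $U_{\mu,m}\cap U_{\mu,n}=\varnothing$ whenever $m\neq n$, each $A_{\mu,n}\in\mathcal{D}$, and $A^\ast\in\mathbf{\Gamma}^\ast$. *)

theory Defs
  imports "HOL-Analysis.Analysis"
begin

section \<open>Spaces\<close>

definition sm_space :: "'a topology \<Rightarrow> bool" where
  "sm_space X \<longleftrightarrow> separable_space X \<and> metrizable_space X"

definition Polish_space :: "'a topology \<Rightarrow> bool" where
  "Polish_space X \<longleftrightarrow> separable_space X \<and> completely_metrizable_space X"

definition zero_dimensional :: "'a topology \<Rightarrow> bool" where
  "zero_dimensional X \<longleftrightarrow> topspace X \<noteq> {} \<and>
     (\<exists>\<B>. (\<forall>V\<in>\<B>. openin X V \<and> closedin X V) \<and>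
          (\<forall>U x. openin X U \<and> x \<in> U \<longrightarrow> (\<exists>V\<in>\<B>. x \<in> V \<and> V \<subseteq> U)))"

definition borel_sigma :: "'a topology \<Rightarrow> 'a measure" where
  "borel_sigma X = sigma (topspace X) {U. openin X U}"

text \<open>The ambient Polish space is taken on the type \<open>nat \<Rightarrow> nat\<close>; by
  \<open>sm_space_homeomorphic_universal\<close> below this is no restriction, every Polish space
  having a homeomorphic copy on that type.\<close>

definition Borel_space :: "'a topology \<Rightarrow> bool" where
  "Borel_space X \<longleftrightarrow>
     (\<exists>(P :: (nat \<Rightarrow> nat) topology) B.
        Polish_space P \<and> B \<in> sets (borel_sigma P) \<and> X homeomorphic_space subtopology P B)"

definition Baire_space :: "(nat \<Rightarrow> nat) topology" where
  "Baire_space = product_topology (\<lambda>_. discrete_topology UNIV) UNIV"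


section \<open>Determinacy\<close>

text \<open>A play is the sequence \<open>z = (x\<^sub>0, y\<^sub>0, x\<^sub>1, y\<^sub>1, \<dots>)\<close>: player I chooses the even
  entries, player II the odd ones. A strategy gives the next move as a function of the finite
  sequence of all previous moves.\<close>

definition determined :: "(nat \<Rightarrow> nat) set \<Rightarrow> bool" where
  "determined S \<longleftrightarrow>
     (\<exists>\<sigma> :: nat list \<Rightarrow> nat. \<forall>z. (\<forall>n. z (2*n) = \<sigma> (map z [0..<2*n])) \<longrightarrow> z \<in> S) \<or>
     (\<exists>\<tau> :: nat list \<Rightarrow> nat. \<forall>z. (\<forall>n. z (2*n+1) = \<tau> (map z [0..<2*n+1])) \<longrightarrow> z \<notin> S)"

definition Det :: "(nat \<Rightarrow> nat) set set \<Rightarrow> bool" where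
  "Det \<S> \<longleftrightarrow> (\<forall>S\<in>\<S>. determined S)"


section \<open>Topological pointclasses\<close>

text \<open>A pointclass is defined on the proper class of all separable metrizable spaces. It is
  represented by its restriction to the spaces whose points are elements of \<open>nat \<Rightarrow> nat\<close>. Every
  separable metrizable space, over any type, has a homeomorphic copy of this form
  (\<open>sm_space_homeomorphic_universal\<close>), and a topological pointclass is invariant under
  homeomorphisms; its value at a space over another type is recovered by transport
  (\<open>pc_at\<close>).\<close>

type_synonym pointclass = "(nat \<Rightarrow> nat) topology \<Rightarrow> (nat \<Rightarrow> nat) set set"

definition topological_pointclass :: "pointclass \<Rightarrow> bool" where
  "topological_pointclass \<Sigma> \<longleftrightarrow>
     (\<forall>Z. sm_space Z \<longrightarrow> \<Sigma> Z \<subseteq> Pow (topspace Z)) \<and>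
     (\<forall>Z W f B. sm_space Z \<and> sm_space W \<and> continuous_map Z W f \<and> B \<in> \<Sigma> W
        \<longrightarrow> f -` B \<inter> topspace Z \<in> \<Sigma> Z)"

definition nice_pointclass :: "pointclass \<Rightarrow> bool" where
  "nice_pointclass \<Sigma> \<longleftrightarrow> topological_pointclass \<Sigma> \<and>
     (\<forall>Z. sm_space Z \<longrightarrow> sets (borel_sigma Z) \<subseteq> \<Sigma> Z) \<and>
     (\<forall>Z. sm_space Z \<longrightarrow> algebra (topspace Z) (\<Sigma> Z)) \<and>
     (\<forall>Z W f B. sm_space Z \<and> sm_space W \<and> f \<in> borel_sigma Z \<rightarrow>\<^sub>M borel_sigma W \<and> B \<in> \<Sigma> W
        \<longrightarrow> f -` B \<inter> topspace Z \<in> \<Sigma> Z) \<and>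
     (\<forall>Z :: (nat \<Rightarrow> nat) topology. sm_space Z \<longrightarrow>
        (\<exists>W j. Borel_space W \<and> embedding_map Z W j \<and> j ` topspace Z \<in> \<Sigma> W) \<longrightarrow>
        (\<forall>W i. Borel_space W \<and> embedding_map Z W i \<longrightarrow> i ` topspace Z \<in> \<Sigma> W))"

definition pc_at :: "pointclass \<Rightarrow> 'a topology \<Rightarrow> 'a set set" where
  "pc_at \<Sigma> Z = {A. A \<subseteq> topspace Z \<and> (\<exists>X h. homeomorphic_map Z X h \<and> h ` A \<in> \<Sigma> X)}"

lemma sm_space_homeomorphic_universal:
  fixes Z :: "'a topology"
  assumes "sm_space Z"
  obtains X :: "(nat \<Rightarrow> nat) topology" and h where "homeomorphic_map Z X h"
proof -
  obtain M d where M: "Metric_space M d" and Z: "Z = Metric_space.mtopology M d"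
    using assms unfolding sm_space_def metrizable_space_def by blast
  interpret Metric_space M d by (rule M)
  obtain C where C: "countable C" "C \<subseteq> M" "mtopology closure_of C = M"
    using assms unfolding sm_space_def separable_space_def Z by auto
  have "\<exists>k. from_nat_into C k \<in> C \<and> d x (from_nat_into C k) < 1 / Suc n" if "x \<in> M" for x n
  proof -
    have "x \<in> mtopology closure_of C" using that C by simp
    then obtain c where "c \<in> C" "c \<in> mball x (1 / Suc n)"
      unfolding metric_closure_of by (auto dest: spec[of _ "1 / Suc n"])
    then show ?thesis
      using from_nat_into_surj[OF C(1) \<open>c \<in> C\<close>] by auto
  qed
  then obtain s where s: "\<And>x n. x \<in> M \<Longrightarrow> from_nat_into C (s x n) \<in> C"
      "\<And>x n. x \<in> M \<Longrightarrow> d x (from_nat_into C (s x n)) < 1 / Suc n"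
    by metis
  have inj: "inj_on s M"
  proof (rule inj_onI, rule ccontr)
    fix x y assume xy: "x \<in> M" "y \<in> M" "s x = s y" "x \<noteq> y"
    then have "d x y > 0" by simp
    then obtain n where n: "1 / Suc n < d x y / 2"
      by (metis half_gt_zero nat_approx_posE)
    let ?c = "from_nat_into C (s x n)"
    have "?c \<in> M" using s(1) xy C by blast
    then have "d x y \<le> d x ?c + d y ?c"
      using triangle[of x ?c y] xy by (simp add: commute)
    moreover have "d x ?c < 1 / Suc n" "d y ?c < 1 / Suc n"
      using s(2)[of x n] s(2)[of y n] xy by auto
    ultimately show False using n by linarith
  qed
  have tsp: "topspace Z = M" by (simp add: Z)
  let ?g = "inv_into M s"
  let ?X = "pullback_topology (s ` M) ?g Z"
  have img: "?g -` U \<inter> s ` M = s ` U" if "U \<subseteq> M" for U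
    using inj that by (auto simp: inv_into_f_f)
  have "topspace ?X = s ` M"
    using img[of M] by (simp add: topspace_pullback_topology tsp)
  moreover have "openin ?X (s ` U) \<longleftrightarrow> openin Z U" if U: "U \<subseteq> M" for U
  proof
    assume "openin ?X (s ` U)"
    then obtain V where V: "openin Z V" "s ` U = ?g -` V \<inter> s ` M"
      unfolding openin_pullback_topology by blast
    have "V \<subseteq> M" using openin_subset[OF V(1)] tsp by simp
    then have "s ` U = s ` V" using V img by simp
    then have "U = V" using inj_on_image_eq_iff[OF inj U \<open>V \<subseteq> M\<close>] by simp
    then show "openin Z U" using V by simp
  next
    assume "openin Z U"
    then show "openin ?X (s ` U)"
      unfolding openin_pullback_topology using img[OF U] by metis
  qed
  moreover have "{x \<in> M. s x \<in> s ` U} = U" if "U \<subseteq> M" for U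
    using that inj by (auto simp: inj_on_def)
  ultimately have "homeomorphic_map Z ?X s"
    using inj unfolding homeomorphic_map_def quotient_map_def tsp
    by (auto simp: subset_image_iff)
  then show thesis by (rule that)
qed

lemma pc_at_eq:
  assumes \<Sigma>: "topological_pointclass \<Sigma>" and Z: "sm_space Z"
  shows "pc_at \<Sigma> Z = \<Sigma> Z"
proof (intro set_eqI iffI)
  fix A assume "A \<in> pc_at \<Sigma> Z"
  then obtain X h where A: "A \<subseteq> topspace Z" and h: "homeomorphic_map Z X h" and B: "h ` A \<in> \<Sigma> X"
    unfolding pc_at_def by blast
  have X: "sm_space X"
    using Z h homeomorphic_map_imp_homeomorphic_space homeomorphic_separable_space
      homeomorphic_metrizable_space unfolding sm_space_def by blast
  have "h -` (h ` A) \<inter> topspace Z \<in> \<Sigma> Z"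
    using \<Sigma> Z X B homeomorphic_imp_continuous_map[OF h] unfolding topological_pointclass_def by blast
  moreover have "h -` (h ` A) \<inter> topspace Z = A"
    using A homeomorphic_imp_injective_map[OF h] by (auto simp: inj_on_def)
  ultimately show "A \<in> \<Sigma> Z" by simp
next
  fix A assume A: "A \<in> \<Sigma> Z"
  then have "A \<subseteq> topspace Z"
    using \<Sigma> Z unfolding topological_pointclass_def by blast
  moreover have "homeomorphic_map Z Z id" "id ` A \<in> \<Sigma> Z" using A by simp_all
  ultimately show "A \<in> pc_at \<Sigma> Z"
    unfolding pc_at_def by blast
qed


section \<open>Wadge classes\<close>

definition dual_class :: "'a topology \<Rightarrow> 'a set set \<Rightarrow> 'a set set" where
  "dual_class Z \<Gamma> = {topspace Z - A | A. A \<in> \<Gamma>}"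

definition selfdual :: "'a topology \<Rightarrow> 'a set set \<Rightarrow> bool" where
  "selfdual Z \<Gamma> \<longleftrightarrow> \<Gamma> = dual_class Z \<Gamma>"

definition Delta_class :: "'a topology \<Rightarrow> 'a set set \<Rightarrow> 'a set set" where
  "Delta_class Z \<Gamma> = \<Gamma> \<inter> dual_class Z \<Gamma>"

definition Wadge_class :: "'a topology \<Rightarrow> 'a set set \<Rightarrow> bool" where
  "Wadge_class Z \<Gamma> \<longleftrightarrow>
     (\<exists>A \<subseteq> topspace Z. \<Gamma> = {f -` A \<inter> topspace Z | f. continuous_map Z Z f})"

definition NSD :: "'a topology \<Rightarrow> 'a set set set" where
  "NSD Z = {\<Gamma>. Wadge_class Z \<Gamma> \<and> \<not> selfdual Z \<Gamma>}"

definition PU1 :: "'a topology \<Rightarrow> 'a set set \<Rightarrow> 'a set set" where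
  "PU1 Z \<Gamma> = {(\<Union>n. A n \<inter> V n) | (A :: nat \<Rightarrow> 'a set) V.
     (\<forall>n. A n \<in> \<Gamma>) \<and> (\<forall>n. fsigma_in Z (V n) \<and> gdelta_in Z (V n)) \<and>
     disjoint_family V \<and> (\<Union>n. V n) = topspace Z}"

definition level_ge_1 :: "'a topology \<Rightarrow> 'a set set \<Rightarrow> bool" where
  "level_ge_1 Z \<Gamma> \<longleftrightarrow> PU1 Z \<Gamma> = \<Gamma>"

definition separation_property :: "'a topology \<Rightarrow> 'a set set \<Rightarrow> bool" where
  "separation_property Z \<Gamma> \<longleftrightarrow>
     (\<forall>A\<in>\<Gamma>. \<forall>B\<in>\<Gamma>. A \<inter> B = {} \<longrightarrow>
        (\<exists>C\<in>Delta_class Z \<Gamma>. A \<subseteq> C \<and> C \<subseteq> topspace Z - B))"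

text \<open>An ordinal is given by a (reflexive) well-order \<open>\<eta>\<close>; its elements \<open>\<mu>\<close> play the role of the
  ordinals below it, and \<open>underS \<eta> \<mu>\<close> is the set of \<open>\<mu>' < \<mu>\<close>.\<close>

definition SD :: "'a topology \<Rightarrow> 'i rel \<Rightarrow> 'a set set \<Rightarrow> 'a set set \<Rightarrow> 'a set set" where
  "SD Z \<eta> \<D> \<Gamma>\<^sub>0 =
     {(\<Union>\<mu>\<in>Field \<eta>. \<Union>n. A \<mu> n \<inter> U \<mu> n - (\<Union>\<mu>'\<in>underS \<eta> \<mu>. \<Union>m. U \<mu>' m)) \<union>
      (A\<^sub>0 - (\<Union>\<mu>\<in>Field \<eta>. \<Union>n. U \<mu> n)) | (A :: 'i \<Rightarrow> nat \<Rightarrow> 'a set) U A\<^sub>0.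
        (\<forall>\<mu>\<in>Field \<eta>. \<forall>n. openin Z (U \<mu> n)) \<and>
        (\<forall>\<mu>\<in>Field \<eta>. \<forall>m n. m \<noteq> n \<longrightarrow> U \<mu> m \<inter> U \<mu> n = {}) \<and>
        (\<forall>\<mu>\<in>Field \<eta>. \<forall>n. A \<mu> n \<in> \<D>) \<and>
        A\<^sub>0 \<in> \<Gamma>\<^sub>0}"

end

theory Submission
  imports Defs
begin

text \<open>
  Let \<open>A\<close> and \<open>B\<close> be disjoint separated differences, with open sets \<open>U\<close> and \<open>V\<close> respectively. Put
  \<open>W \<mu> = (\<Union>n. U \<mu> n) \<union> (\<Union>n. V \<mu> n)\<close>. Since \<open>Z\<close> is zero-dimensional, \<open>W \<mu>\<close> splits into a sequence of
  disjoint clopen pieces, each of them inside a single \<open>U \<mu> n\<close> or a single \<open>V \<mu> n\<close>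
  (\<open>disjoint_clopen_refinement\<close>). Consider the points of such a piece that belong to no earlier
  \<open>W \<mu>'\<close>. In the first case \<open>A\<close> coincides there with one set of \<open>\<D>\<close>, and that set separates; in
  the second case \<open>B\<close> does, and the complement of that set separates. So, on the union of all the
  \<open>W \<mu>\<close>, there is a separating set that is assembled from members of \<open>\<D>\<close> along the pieces, and
  its complement is of the same form because \<open>\<D>\<close> is closed under complements.

  What remains is the closed set \<open>F\<close> of points outside every \<open>W \<mu>\<close>. On it, \<open>A\<close> and \<open>B\<close> coincide
  with members \<open>A\<^sub>0\<close> and \<open>B\<^sub>0\<close> of \<open>\<Gamma>\<^sub>0\<close>, which however may meet outside \<open>F\<close>. A non-empty
  closed subset of a zero-dimensional separable metrizable space is a retract of it
  (\<open>zero_dimensional_retraction\<close>), and the preimages of \<open>A\<^sub>0\<close> and \<open>B\<^sub>0\<close> under a retraction onto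
  \<open>F\<close> are disjoint, still lie in \<open>\<Gamma>\<^sub>0\<close>, and are unchanged on \<open>F\<close>. The separation property of
  \<open>\<Gamma>\<^sub>0\<close> applies to them and supplies the last piece of the separating set, which lies in \<open>\<Gamma>\<^sub>0\<close> together
  with its complement.
\<close>

section \<open>Zero-dimensional separable metrizable spaces\<close>

lemma sm_space_second_countable:
  assumes "sm_space Z"
  shows "second_countable Z"
proof -
  obtain M d where M: "Metric_space M d" and Z: "Z = Metric_space.mtopology M d"
    using assms unfolding sm_space_def metrizable_space_def by blast
  interpret Metric_space M d by (rule M)
  obtain C where C: "countable C" "C \<subseteq> M" "mtopology closure_of C = M"
    using assms unfolding sm_space_def separable_space_def Z by auto
  define \<B> where "\<B> = (\<lambda>(c, n). mball c (1 / Suc n)) ` (C \<times> UNIV)"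
  have "\<exists>V\<in>\<B>. x \<in> V \<and> V \<subseteq> U" if U: "openin mtopology U" "x \<in> U" for U x
  proof -
    obtain e where e: "e > 0" "mball x e \<subseteq> U" and x: "x \<in> M"
      using U unfolding openin_mtopology by blast
    obtain n where n: "1 / Suc n < e / 2" using e(1) by (metis half_gt_zero nat_approx_posE)
    have "x \<in> mtopology closure_of C" using x C by simp
    then obtain c where c: "c \<in> C" "d x c < 1 / Suc n"
      unfolding metric_closure_of by (auto dest: spec[of _ "1 / Suc n"])
    have "mball c (1 / Suc n) \<subseteq> mball x e"
    proof
      fix y assume y: "y \<in> mball c (1 / Suc n)"
      then have "d x y \<le> d x c + d c y" using triangle x by auto
      also have "\<dots> < e" using c(2) n y by (simp only: in_mball) linarith
      finally show "y \<in> mball x e" using x y by simp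
    qed
    moreover have "x \<in> mball c (1 / Suc n)" using x c C by (auto simp: commute)
    ultimately show ?thesis using c(1) e(2) unfolding \<B>_def by blast
  qed
  moreover have "countable \<B>" using C(1) unfolding \<B>_def by simp
  moreover have "\<forall>V\<in>\<B>. openin mtopology V" unfolding \<B>_def by auto
  ultimately show ?thesis unfolding second_countable_def Z by meson
qed

text \<open>By the Lindelof property countably many clopen sets inside members of the cover suffice;
  subtracting from each of them the finitely many earlier ones keeps them clopen and makes them
  disjoint.\<close>

lemma disjoint_clopen_refinement:
  fixes Z :: "'a topology"
  assumes Z: "sm_space Z" "zero_dimensional Z"
    and op: "\<And>V. V \<in> \<O> \<Longrightarrow> openin Z V" and ne: "\<O> \<noteq> {}"
  obtains W :: "nat \<Rightarrow> 'a set"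
  where "\<And>k. openin Z (W k)" "\<And>k. closedin Z (W k)"
    and "\<And>j k. j \<noteq> k \<Longrightarrow> W j \<inter> W k = {}"
    and "\<And>k. \<exists>V\<in>\<O>. W k \<subseteq> V" and "(\<Union>k. W k) = \<Union>\<O>"
proof -
  define \<C> where "\<C> = {C. openin Z C \<and> closedin Z C \<and> (\<exists>V\<in>\<O>. C \<subseteq> V)}"
  have C_cover: "\<Union>\<C> = \<Union>\<O>"
  proof
    show "\<Union>\<O> \<subseteq> \<Union>\<C>"
    proof
      fix x assume "x \<in> \<Union>\<O>"
      then obtain V where V: "V \<in> \<O>" "x \<in> V" by blast
      then obtain C where "openin Z C" "closedin Z C" "x \<in> C" "C \<subseteq> V"
        using Z(2) op[OF V(1)] unfolding zero_dimensional_def by metis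
      then show "x \<in> \<Union>\<C>" using V unfolding \<C>_def by blast
    qed
  qed (auto simp: \<C>_def)
  have "second_countable Z" by (rule sm_space_second_countable[OF Z(1)])
  then have lind: "Lindelof_space (subtopology Z (\<Union>\<C>))"
    by (simp add: second_countable_imp_Lindelof_space second_countable_subtopology)
  have C_open: "\<forall>C\<in>\<C>. openin Z C" unfolding \<C>_def by blast
  then have "\<Union>\<C> \<subseteq> topspace Z" using openin_subset by blast
  from lind[unfolded Lindelof_space_subtopology_subset[OF this], rule_format, of \<C>]
  obtain \<F> where \<F>: "countable \<F>" "\<F> \<subseteq> \<C>" "\<Union>\<C> \<subseteq> \<Union>\<F>"
    using C_open by auto
  then have F_un: "\<Union>\<F> = \<Union>\<C>" by blast
  define c where "c = from_nat_into (insert {} \<F>)"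
  have c: "range c = insert {} \<F>"
    unfolding c_def using \<F>(1) by (intro range_from_nat_into) auto
  have "{} \<in> \<C>" using ne unfolding \<C>_def by auto
  then have cC: "c k \<in> \<C>" for k
    using c \<F>(2) by (metis insert_subset rangeI subset_iff)
  show thesis
  proof (rule that[of "disjointed c"])
    fix k
    have "disjointed c k = c k - (\<Union>j<k. c j)"
      by (simp add: disjointed_def lessThan_atLeast0)
    then show "openin Z (disjointed c k)" "closedin Z (disjointed c k)"
      using cC unfolding \<C>_def by (auto intro!: openin_diff closedin_diff closedin_Union openin_Union)
    show "\<exists>V\<in>\<O>. disjointed c k \<subseteq> V"
      using cC[of k] disjointed_subset[of c k] unfolding \<C>_def by blast
  next
    fix j k :: nat assume "j \<noteq> k"
    then show "disjointed c j \<inter> disjointed c k = {}"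
      using disjoint_family_disjointed[of c] unfolding disjoint_family_on_def by simp
  next
    have "(\<Union>k. c k) = \<Union>\<F>" using c by auto
    then show "(\<Union>k. disjointed c k) = \<Union>\<O>"
      using UN_disjointed_eq[of c] F_un C_cover by simp
  qed
qed

text \<open>Each point outside \<open>F\<close> goes to a point of \<open>F\<close> that is nearly closest to it, and the choice is
  locally constant because it is made once for each piece of a clopen partition of the complement
  of \<open>F\<close>. As a point moves by at most a constant multiple of its distance from every point of \<open>F\<close>,
  the map is continuous at the points of \<open>F\<close> too.\<close>

lemma zero_dimensional_retraction:
  fixes Z :: "'a topology"
  assumes Z: "sm_space Z" "zero_dimensional Z"
    and F: "closedin Z F" "F \<noteq> {}"
  obtains r where "continuous_map Z Z r" "r ` topspace Z \<subseteq> F" "\<And>x. x \<in> F \<Longrightarrow> r x = x"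
proof -
  obtain M d where M: "Metric_space M d" and Zd: "Z = Metric_space.mtopology M d"
    using Z(1) unfolding sm_space_def metrizable_space_def by blast
  interpret Metric_space M d by (rule M)
  have tsp: "topspace Z = M" by (simp add: Zd)
  have FM: "F \<subseteq> M" using closedin_subset[OF F(1)] tsp by simp
  define \<O> where
    "\<O> = {V. openin Z V \<and> V \<inter> F = {} \<and> (\<exists>q\<in>F. \<forall>y\<in>V. \<forall>f\<in>F. d y q \<le> 5 * d y f)}"
  have cover: "\<Union>\<O> = M - F"
  proof
    show "\<Union>\<O> \<subseteq> M - F" using openin_subset tsp unfolding \<O>_def by blast
    show "M - F \<subseteq> \<Union>\<O>"
    proof
      fix x assume x: "x \<in> M - F"
      have "openin mtopology (M - F)"
        using F(1) tsp Zd by (metis openin_diff openin_topspace)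
      then obtain e where e: "e > 0" "mball x e \<subseteq> M - F"
        using x unfolding openin_mtopology by blast
      define \<delta> where "\<delta> = Inf (d x ` F)"
      have e_le: "e \<le> d x f" if "f \<in> F" for f
        using that e x FM by (force simp: not_less[symmetric])
      have le: "\<delta> \<le> d x f" if "f \<in> F" for f
        unfolding \<delta>_def using that by (intro cInf_lower bdd_belowI[of _ 0]) auto
      have "e \<le> \<delta>" unfolding \<delta>_def using F(2) e_le by (intro cInf_greatest) auto
      then have \<delta>: "\<delta> > 0" using e by simp
      then have "Inf (d x ` F) < 2 * \<delta>" by (simp add: \<delta>_def)
      then obtain q where q: "q \<in> F" "d x q < 2 * \<delta>"
        using cInf_lessD[of "d x ` F" "2 * \<delta>"] F(2) by auto
      (* with this radius, every y in the ball has distance at least \<delta>/2 from F, while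
         d y q < \<delta>/2 + 2 * \<delta>; the quotient of the two bounds is the factor 5 *)
      let ?V = "mball x (\<delta> / 2)"
      have bound: "\<delta> / 2 < d y f" "d y q < 5 / 2 * \<delta>" if "y \<in> ?V" "f \<in> F" for y f
      proof -
        have "y \<in> M" "f \<in> M" "q \<in> M" "x \<in> M" "d x y < \<delta> / 2"
          using that FM q x by auto
        then show "\<delta> / 2 < d y f" "d y q < 5 / 2 * \<delta>"
          using triangle[of x y f] triangle[of y x q] commute[of x y] le[OF that(2)] q(2) by linarith+
      qed
      have "?V \<inter> F = {}"
      proof (rule ccontr)
        assume "?V \<inter> F \<noteq> {}"
        then obtain y where "y \<in> ?V" "y \<in> F" by blast
        then show False using bound(1)[of y y] FM \<delta> by auto
      qed
      moreover have "\<forall>y\<in>?V. \<forall>f\<in>F. d y q \<le> 5 * d y f"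
        using bound by force
      ultimately have "?V \<in> \<O>" using q(1) unfolding \<O>_def Zd by auto
      moreover have "x \<in> ?V" using x \<delta> by simp
      ultimately show "x \<in> \<Union>\<O>" by blast
    qed
  qed
  have O_open: "\<And>V. V \<in> \<O> \<Longrightarrow> openin Z V" unfolding \<O>_def by blast
  have O_ne: "\<O> \<noteq> {}"
  proof -
    have "{} \<in> \<O>" using F(2) unfolding \<O>_def by auto
    then show ?thesis by blast
  qed
  obtain W :: "nat \<Rightarrow> 'a set" where W_open: "\<And>k. openin Z (W k)"
    and W_disj: "\<And>j k. j \<noteq> k \<Longrightarrow> W j \<inter> W k = {}"
    and W_ref: "\<And>k. \<exists>V\<in>\<O>. W k \<subseteq> V" and W_un: "(\<Union>k. W k) = \<Union>\<O>"
    using disjoint_clopen_refinement[OF Z O_open O_ne] by metis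
  have "\<exists>q\<in>F. \<forall>y\<in>W k. \<forall>f\<in>F. d y q \<le> 5 * d y f" for k
    using W_ref[of k] unfolding \<O>_def by blast
  then obtain p where p: "\<And>k. p k \<in> F"
    "\<And>k y f. y \<in> W k \<Longrightarrow> f \<in> F \<Longrightarrow> d y (p k) \<le> 5 * d y f"
    by metis
  define r where "r x = (if x \<in> F then x else p (THE k. x \<in> W k))" for x
  have WF: "W k \<inter> F = {}" for k using W_un cover by blast
  have r_W: "r x = p k" if "x \<in> W k" for x k
  proof -
    have "(THE k. x \<in> W k) = k" using that W_disj by (intro the_equality) blast+
    moreover have "x \<notin> F" using that WF by blast
    ultimately show ?thesis by (simp add: r_def)
  qed
  have piece: "\<exists>k. x \<in> W k" if "x \<in> M - F" for x
  proof -
    have "x \<in> (\<Union>k. W k)" using that W_un cover by simp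
    then show ?thesis by simp
  qed
  have r_F: "r x \<in> F" and near: "\<And>f. f \<in> F \<Longrightarrow> d x (r x) \<le> 5 * d x f" if xM: "x \<in> M" for x
  proof -
    consider "x \<in> F" | k where "x \<in> W k" using piece[of x] xM by blast
    then have "r x \<in> F \<and> (\<forall>f\<in>F. d x (r x) \<le> 5 * d x f)"
    proof cases
      case 1
      then show ?thesis using FM by (auto simp: r_def subset_iff)
    next
      case 2
      then show ?thesis using r_W[OF 2] p(1) p(2)[OF 2] by simp
    qed
    then show "r x \<in> F" "\<And>f. f \<in> F \<Longrightarrow> d x (r x) \<le> 5 * d x f" by blast+
  qed
  have "continuous_map Z Z r"
    unfolding continuous_map
  proof (intro conjI allI impI)
    show "r ` topspace Z \<subseteq> topspace Z" using r_F FM tsp by auto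
    fix G assume G: "openin Z G"
    show "openin Z {x \<in> topspace Z. r x \<in> G}"
    proof (subst openin_subopen, intro ballI)
      fix x assume "x \<in> {x \<in> topspace Z. r x \<in> G}"
      then have x: "x \<in> M" "r x \<in> G" by (auto simp: tsp)
      show "\<exists>T. openin Z T \<and> x \<in> T \<and> T \<subseteq> {x \<in> topspace Z. r x \<in> G}"
      proof (cases "x \<in> F")
        case False
        then obtain k where "x \<in> W k" using piece x by blast
        then show ?thesis
          using W_open[of k] openin_subset[OF W_open[of k]] r_W x(2) by (intro exI[of _ "W k"]) auto
      next
        case True
        then have "x \<in> G" using x by (simp add: r_def)
        then obtain e where e: "e > 0" "mball x e \<subseteq> G"
          using G unfolding Zd openin_mtopology by blast
        (* y is within e/6 of x and moves by at most 5 * e/6 *)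
        have "r y \<in> G" if "y \<in> mball x (e / 6)" for y
        proof -
          have y: "y \<in> M" "d x y < e / 6" using that by auto
          have ry: "r y \<in> M" using r_F y FM by blast
          have "d x (r y) \<le> d x y + d y (r y)" using triangle x y ry by blast
          then have "d x (r y) < e"
            using near[OF y(1) True] y(2) commute[of x y] by linarith
          then show ?thesis using e(2) x ry by auto
        qed
        then show ?thesis
          using x e(1) by (intro exI[of _ "mball x (e / 6)"]) (auto simp: Zd)
      qed
    qed
  qed
  moreover have "r ` topspace Z \<subseteq> F" using r_F tsp by blast
  moreover have "r x = x" if "x \<in> F" for x using that by (simp add: r_def)
  ultimately show thesis by (rule that)
qed

section \<open>Separated differences\<close>

definition sep_diff ::
    "'i rel \<Rightarrow> ('i \<Rightarrow> nat \<Rightarrow> 'a set) \<Rightarrow> ('i \<Rightarrow> nat \<Rightarrow> 'a set) \<Rightarrow> 'a set \<Rightarrow> 'a set" where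
  "sep_diff \<eta> A U A\<^sub>0 =
     (\<Union>\<mu>\<in>Field \<eta>. \<Union>n. A \<mu> n \<inter> U \<mu> n - (\<Union>\<mu>'\<in>underS \<eta> \<mu>. \<Union>m. U \<mu>' m)) \<union>
     (A\<^sub>0 - (\<Union>\<mu>\<in>Field \<eta>. \<Union>n. U \<mu> n))"

definition enters_at :: "'i rel \<Rightarrow> ('i \<Rightarrow> nat \<Rightarrow> 'a set) \<Rightarrow> 'a \<Rightarrow> 'i \<Rightarrow> nat \<Rightarrow> bool" where
  "enters_at \<eta> U x \<mu> n \<longleftrightarrow>
     \<mu> \<in> Field \<eta> \<and> x \<in> U \<mu> n \<and> (\<forall>\<mu>'\<in>underS \<eta> \<mu>. \<forall>m. x \<notin> U \<mu>' m)"

lemma enters_at_cases: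
  assumes "Well_order \<eta>"
  obtains "\<And>\<mu> n. \<mu> \<in> Field \<eta> \<Longrightarrow> x \<notin> U \<mu> n" | \<mu> n where "enters_at \<eta> U x \<mu> n"
proof (cases "\<exists>\<mu>\<in>Field \<eta>. \<exists>n. x \<in> U \<mu> n")
  case True
  then obtain \<mu> where \<mu>: "\<mu> \<in> {\<mu> \<in> Field \<eta>. \<exists>n. x \<in> U \<mu> n}" by blast
  have "wf (\<eta> - Id)" using assms unfolding well_order_on_def by blast
  then obtain \<nu> where \<nu>: "\<nu> \<in> {\<mu> \<in> Field \<eta>. \<exists>n. x \<in> U \<mu> n}"
    "\<And>\<mu>. (\<mu>, \<nu>) \<in> \<eta> - Id \<Longrightarrow> \<mu> \<notin> {\<mu> \<in> Field \<eta>. \<exists>n. x \<in> U \<mu> n}"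
    by (rule wfE_min[OF _ \<mu>]) blast
  then have "\<forall>\<mu>'\<in>underS \<eta> \<nu>. \<forall>m. x \<notin> U \<mu>' m"
    unfolding underS_def by (auto intro: FieldI1)
  then show ?thesis using \<nu> that(2) unfolding enters_at_def by blast
next
  case False
  then show ?thesis using that(1) by blast
qed

lemma sep_diff_at_entry:
  assumes wo: "Well_order \<eta>"
    and disj: "\<forall>\<mu>\<in>Field \<eta>. \<forall>m n. m \<noteq> n \<longrightarrow> U \<mu> m \<inter> U \<mu> n = {}"
    and x: "enters_at \<eta> U x \<mu> n"
  shows "x \<in> sep_diff \<eta> A U A\<^sub>0 \<longleftrightarrow> x \<in> A \<mu> n"
proof
  assume "x \<in> A \<mu> n"
  then show "x \<in> sep_diff \<eta> A U A\<^sub>0"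
    using x unfolding sep_diff_def enters_at_def by blast
next
  assume "x \<in> sep_diff \<eta> A U A\<^sub>0"
  then obtain \<nu> m where y: "enters_at \<eta> U x \<nu> m" "x \<in> A \<nu> m"
    using x unfolding sep_diff_def enters_at_def by blast
  have "\<nu> = \<mu> \<or> \<nu> \<in> underS \<eta> \<mu> \<or> \<mu> \<in> underS \<eta> \<nu>"
    using wo x y unfolding enters_at_def well_order_on_def linear_order_on_def total_on_def underS_def
    by blast
  then have "\<nu> = \<mu>" using x y(1) unfolding enters_at_def by blast
  moreover from this have "m = n" using x y(1) disj unfolding enters_at_def by blast
  ultimately show "x \<in> A \<mu> n" using y by simp
qed

lemma sep_diff_outside:
  assumes "\<And>\<mu> n. \<mu> \<in> Field \<eta> \<Longrightarrow> x \<notin> U \<mu> n"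
  shows "x \<in> sep_diff \<eta> A U A\<^sub>0 \<longleftrightarrow> x \<in> A\<^sub>0"
  using assms unfolding sep_diff_def by blast

lemma sep_diff_Compl:
  assumes wo: "Well_order \<eta>"
    and disj: "\<forall>\<mu>\<in>Field \<eta>. \<forall>m n. m \<noteq> n \<longrightarrow> U \<mu> m \<inter> U \<mu> n = {}"
    and sub: "\<And>\<mu> n. \<mu> \<in> Field \<eta> \<Longrightarrow> U \<mu> n \<subseteq> S"
  shows "S - sep_diff \<eta> A U A\<^sub>0 = sep_diff \<eta> (\<lambda>\<mu> n. S - A \<mu> n) U (S - A\<^sub>0)"
proof (rule set_eqI)
  fix x
  show "x \<in> S - sep_diff \<eta> A U A\<^sub>0 \<longleftrightarrow> x \<in> sep_diff \<eta> (\<lambda>\<mu> n. S - A \<mu> n) U (S - A\<^sub>0)"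
  proof (rule enters_at_cases[OF wo, of x U])
    assume "\<And>\<mu> n. \<mu> \<in> Field \<eta> \<Longrightarrow> x \<notin> U \<mu> n"
    then show ?thesis by (simp add: sep_diff_outside)
  next
    fix \<mu> n assume "enters_at \<eta> U x \<mu> n"
    then show ?thesis
      by (simp add: sep_diff_at_entry[OF wo disj])
  qed
qed

lemma sep_diff_in_SD:
  assumes "\<forall>\<mu>\<in>Field \<eta>. \<forall>n. openin Z (U \<mu> n)"
    and "\<forall>\<mu>\<in>Field \<eta>. \<forall>m n. m \<noteq> n \<longrightarrow> U \<mu> m \<inter> U \<mu> n = {}"
    and "\<forall>\<mu>\<in>Field \<eta>. \<forall>n. A \<mu> n \<in> \<D>" and "A\<^sub>0 \<in> \<Gamma>\<^sub>0"
  shows "sep_diff \<eta> A U A\<^sub>0 \<in> SD Z \<eta> \<D> \<Gamma>\<^sub>0"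
  unfolding SD_def sep_diff_def using assms by blast

lemma in_SD_E:
  assumes "S \<in> SD Z \<eta> \<D> \<Gamma>\<^sub>0"
  obtains A U A\<^sub>0 where "S = sep_diff \<eta> A U A\<^sub>0" "\<forall>\<mu>\<in>Field \<eta>. \<forall>n. openin Z (U \<mu> n)"
    and "\<forall>\<mu>\<in>Field \<eta>. \<forall>m n. m \<noteq> n \<longrightarrow> U \<mu> m \<inter> U \<mu> n = {}"
    and "\<forall>\<mu>\<in>Field \<eta>. \<forall>n. A \<mu> n \<in> \<D>" "A\<^sub>0 \<in> \<Gamma>\<^sub>0"
  using assms unfolding SD_def sep_diff_def by blast

section \<open>Separation\<close>

text \<open>Pulling back along a retraction onto \<open>F\<close> makes sets that are disjoint on \<open>F\<close> disjoint
  everywhere. If \<open>F\<close> is empty there is nothing to separate, but then \<open>Delta_class Z \<Gamma>\<close> may be empty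
  as well (for instance for \<open>\<Gamma> = {topspace Z}\<close>); so the conclusion asks for a set of \<open>\<Gamma>\<close>
  and for a second one that is its complement on \<open>F\<close> only.\<close>

lemma separation_on_closed_subset:
  assumes Z: "sm_space Z" "zero_dimensional Z" and F: "closedin Z F"
    and pre: "\<And>f S. continuous_map Z Z f \<Longrightarrow> S \<in> \<Gamma> \<Longrightarrow> f -` S \<inter> topspace Z \<in> \<Gamma>"
    and sep: "separation_property Z \<Gamma>"
    and AB: "A \<in> \<Gamma>" "B \<in> \<Gamma>" "A \<inter> B \<inter> F = {}"
  obtains C D where "C \<in> \<Gamma>" "D \<in> \<Gamma>" "C \<inter> F = F - D" "A \<inter> F \<subseteq> C" "B \<inter> C \<inter> F = {}"
proof (cases "F = {}")
  case True
  then show thesis using AB by (intro that[of A A]) auto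
next
  case False
  obtain r where r: "continuous_map Z Z r" "r ` topspace Z \<subseteq> F" "\<And>x. x \<in> F \<Longrightarrow> r x = x"
    using zero_dimensional_retraction[OF Z F False] by blast
  let ?A = "r -` A \<inter> topspace Z" and ?B = "r -` B \<inter> topspace Z"
  have FZ: "F \<subseteq> topspace Z" using F by (rule closedin_subset)
  have "?A \<inter> ?B = {}" using r(2) AB(3) by blast
  then obtain C where C: "C \<in> Delta_class Z \<Gamma>" "?A \<subseteq> C" "C \<subseteq> topspace Z - ?B"
    using sep pre[OF r(1)] AB unfolding separation_property_def by meson
  then obtain D where D: "D \<in> \<Gamma>" "C = topspace Z - D"
    unfolding Delta_class_def dual_class_def by blast
  show thesis
  proof (rule that[of C D])
    show "C \<in> \<Gamma>" using C unfolding Delta_class_def by blast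
    show "D \<in> \<Gamma>" by fact
    show "C \<inter> F = F - D" using D FZ by blast
    show "A \<inter> F \<subseteq> C" "B \<inter> C \<inter> F = {}" using C r(3) FZ by fastforce+
  qed
qed

theorem separation_property_SD:
  fixes Z :: "'a topology" and \<eta> :: "'i rel"
  assumes Z: "sm_space Z" "zero_dimensional Z" and wo: "Well_order \<eta>"
    and D_sub: "\<D> \<subseteq> Pow (topspace Z)"
    and D_compl: "\<And>S. S \<in> \<D> \<Longrightarrow> topspace Z - S \<in> \<D>"
    and G_sub: "\<Gamma>\<^sub>0 \<subseteq> Pow (topspace Z)"
    and pre: "\<And>f S. continuous_map Z Z f \<Longrightarrow> S \<in> \<Gamma>\<^sub>0 \<Longrightarrow> f -` S \<inter> topspace Z \<in> \<Gamma>\<^sub>0"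
    and sep: "separation_property Z \<Gamma>\<^sub>0"
  shows "separation_property Z (SD Z \<eta> \<D> \<Gamma>\<^sub>0)"
  unfolding separation_property_def
proof (intro ballI impI)
  fix S T assume S: "S \<in> SD Z \<eta> \<D> \<Gamma>\<^sub>0" and T: "T \<in> SD Z \<eta> \<D> \<Gamma>\<^sub>0" and ST: "S \<inter> T = {}"
  obtain A U A\<^sub>0 where S_eq: "S = sep_diff \<eta> A U A\<^sub>0"
    and U: "\<forall>\<mu>\<in>Field \<eta>. \<forall>n. openin Z (U \<mu> n)"
    and U_disj: "\<forall>\<mu>\<in>Field \<eta>. \<forall>m n. m \<noteq> n \<longrightarrow> U \<mu> m \<inter> U \<mu> n = {}"
    and A: "\<forall>\<mu>\<in>Field \<eta>. \<forall>n. A \<mu> n \<in> \<D>" and A\<^sub>0: "A\<^sub>0 \<in> \<Gamma>\<^sub>0"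
    by (rule in_SD_E[OF S])
  obtain B V B\<^sub>0 where T_eq: "T = sep_diff \<eta> B V B\<^sub>0"
    and V: "\<forall>\<mu>\<in>Field \<eta>. \<forall>n. openin Z (V \<mu> n)"
    and V_disj: "\<forall>\<mu>\<in>Field \<eta>. \<forall>m n. m \<noteq> n \<longrightarrow> V \<mu> m \<inter> V \<mu> n = {}"
    and B: "\<forall>\<mu>\<in>Field \<eta>. \<forall>n. B \<mu> n \<in> \<D>" and B\<^sub>0: "B\<^sub>0 \<in> \<Gamma>\<^sub>0"
    by (rule in_SD_E[OF T])
  define refines where "refines \<mu> W \<longleftrightarrow> (\<forall>k. openin Z (W k)) \<and> (\<forall>j k. j \<noteq> k \<longrightarrow> W j \<inter> W k = {}) \<and>
      (\<forall>k. \<exists>n. W k \<subseteq> U \<mu> n \<or> W k \<subseteq> V \<mu> n) \<and> (\<Union>k. W k) = (\<Union>n. U \<mu> n \<union> V \<mu> n)"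
    for \<mu> and W :: "nat \<Rightarrow> 'a set"
  have "\<exists>W. refines \<mu> W" if "\<mu> \<in> Field \<eta>" for \<mu>
  proof -
    let ?O = "range (U \<mu>) \<union> range (V \<mu>)"
    have op: "\<And>G. G \<in> ?O \<Longrightarrow> openin Z G" using U V that by blast
    have ne: "?O \<noteq> {}" by blast
    obtain W :: "nat \<Rightarrow> 'a set" where W: "\<And>k. openin Z (W k)"
      "\<And>j k. j \<noteq> k \<Longrightarrow> W j \<inter> W k = {}"
      "\<And>k. \<exists>G\<in>?O. W k \<subseteq> G" "(\<Union>k. W k) = \<Union>?O"
      using disjoint_clopen_refinement[OF Z op ne] by metis
    have "\<exists>n. W k \<subseteq> U \<mu> n \<or> W k \<subseteq> V \<mu> n" for k using W(3)[of k] by blast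
    moreover have "\<Union>?O = (\<Union>n. U \<mu> n \<union> V \<mu> n)" by blast
    ultimately have "refines \<mu> W" using W unfolding refines_def by simp
    then show ?thesis by blast
  qed
  then obtain W where "\<And>\<mu>. \<mu> \<in> Field \<eta> \<Longrightarrow> refines \<mu> (W \<mu>)" by metis
  then have W: "\<forall>\<mu>\<in>Field \<eta>. \<forall>k. openin Z (W \<mu> k)"
    and W_disj: "\<forall>\<mu>\<in>Field \<eta>. \<forall>j k. j \<noteq> k \<longrightarrow> W \<mu> j \<inter> W \<mu> k = {}"
    and W_ref: "\<And>\<mu> k. \<mu> \<in> Field \<eta> \<Longrightarrow> \<exists>n. W \<mu> k \<subseteq> U \<mu> n \<or> W \<mu> k \<subseteq> V \<mu> n"
    and W_un: "\<And>\<mu>. \<mu> \<in> Field \<eta> \<Longrightarrow> (\<Union>k. W \<mu> k) = (\<Union>n. U \<mu> n \<union> V \<mu> n)"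
    unfolding refines_def by simp_all
  have U_W: "U \<mu> n \<subseteq> (\<Union>k. W \<mu> k)" and V_W: "V \<mu> n \<subseteq> (\<Union>k. W \<mu> k)" if "\<mu> \<in> Field \<eta>" for \<mu> n
    unfolding W_un[OF that] by blast+
  have under: "\<mu>' \<in> Field \<eta>" if "\<mu>' \<in> underS \<eta> \<mu>" for \<mu>' \<mu>
    using that unfolding underS_def by (blast intro: FieldI1)
  have entry: "enters_at \<eta> U x \<mu> n" if "enters_at \<eta> W x \<mu> k" "W \<mu> k \<subseteq> U \<mu> n" for x \<mu> k n
    using that U_W[OF under] unfolding enters_at_def by blast
  have entry': "enters_at \<eta> V x \<mu> n" if "enters_at \<eta> W x \<mu> k" "W \<mu> k \<subseteq> V \<mu> n" for x \<mu> k n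
    using that V_W[OF under] unfolding enters_at_def by blast
  have outside: "x \<notin> U \<mu> n" "x \<notin> V \<mu> n"
    if "\<And>\<mu> k. \<mu> \<in> Field \<eta> \<Longrightarrow> x \<notin> W \<mu> k" "\<mu> \<in> Field \<eta>" for x \<mu> n
    using that U_W[OF that(2)] V_W[OF that(2)] by blast+

  (* on the piece W \<mu> k, the separating set is E \<mu> k, one of the A \<mu> n or the complement of one of
     the B \<mu> n *)
  have "\<exists>E\<in>\<D>. \<forall>x. enters_at \<eta> W x \<mu> k \<longrightarrow> (x \<in> S \<longrightarrow> x \<in> E) \<and> (x \<in> E \<longrightarrow> x \<notin> T)"
    if \<mu>: "\<mu> \<in> Field \<eta>" for \<mu> k
  proof -
    obtain n where "W \<mu> k \<subseteq> U \<mu> n \<or> W \<mu> k \<subseteq> V \<mu> n" using W_ref[OF \<mu>] by blast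
    then show ?thesis
    proof
      assume sub: "W \<mu> k \<subseteq> U \<mu> n"
      have "x \<in> S \<longleftrightarrow> x \<in> A \<mu> n" if "enters_at \<eta> W x \<mu> k" for x
        unfolding S_eq by (rule sep_diff_at_entry[OF wo U_disj entry[OF that sub]])
      then show ?thesis using A \<mu> ST by (intro bexI[of _ "A \<mu> n"]) auto
    next
      assume sub: "W \<mu> k \<subseteq> V \<mu> n"
      have "x \<in> T \<longleftrightarrow> x \<in> B \<mu> n" "x \<in> topspace Z" if "enters_at \<eta> W x \<mu> k" for x
      proof -
        show "x \<in> T \<longleftrightarrow> x \<in> B \<mu> n"
          unfolding T_eq by (rule sep_diff_at_entry[OF wo V_disj entry'[OF that sub]])
        show "x \<in> topspace Z"
          using that W openin_subset unfolding enters_at_def by blast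
      qed
      then show ?thesis
        using B D_compl \<mu> ST by (intro bexI[of _ "topspace Z - B \<mu> n"]) auto
    qed
  qed
  then obtain E where E: "\<forall>\<mu>\<in>Field \<eta>. \<forall>k. E \<mu> k \<in> \<D>"
    and E_sep: "\<And>\<mu> k x. enters_at \<eta> W x \<mu> k \<Longrightarrow> (x \<in> S \<longrightarrow> x \<in> E \<mu> k) \<and> (x \<in> E \<mu> k \<longrightarrow> x \<notin> T)"
    using enters_at_def by metis

  define F where "F = topspace Z - (\<Union>\<mu>\<in>Field \<eta>. \<Union>k. W \<mu> k)"
  have F: "closedin Z F"
    unfolding F_def using W by (intro closedin_diff closedin_topspace openin_Union) auto
  have F_iff: "x \<in> F \<longleftrightarrow> (\<forall>\<mu>\<in>Field \<eta>. \<forall>k. x \<notin> W \<mu> k)" if "x \<in> topspace Z" for x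
    using that unfolding F_def by blast
  have S_F: "x \<in> S \<longleftrightarrow> x \<in> A\<^sub>0" and T_F: "x \<in> T \<longleftrightarrow> x \<in> B\<^sub>0" if "x \<in> F" for x
    unfolding S_eq T_eq using that outside[of x] F_def by (auto intro!: sep_diff_outside)
  then have "A\<^sub>0 \<inter> B\<^sub>0 \<inter> F = {}" using ST by blast
  then obtain C\<^sub>0 D\<^sub>0 where C\<^sub>0: "C\<^sub>0 \<in> \<Gamma>\<^sub>0" "D\<^sub>0 \<in> \<Gamma>\<^sub>0" "C\<^sub>0 \<inter> F = F - D\<^sub>0" "A\<^sub>0 \<inter> F \<subseteq> C\<^sub>0" "B\<^sub>0 \<inter> C\<^sub>0 \<inter> F = {}"
    using separation_on_closed_subset[OF Z F pre sep A\<^sub>0 B\<^sub>0] by blast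

  let ?C = "sep_diff \<eta> E W C\<^sub>0"
  let ?D = "sep_diff \<eta> (\<lambda>\<mu> k. topspace Z - E \<mu> k) W D\<^sub>0"
  have sub: "?C \<subseteq> topspace Z" "S \<subseteq> topspace Z"
    using D_sub G_sub E A A\<^sub>0 C\<^sub>0 unfolding S_eq sep_diff_def by blast+
  have "topspace Z - ?C = ?D"
  proof -
    have "topspace Z - ?C = sep_diff \<eta> (\<lambda>\<mu> k. topspace Z - E \<mu> k) W (topspace Z - C\<^sub>0)"
    proof (rule sep_diff_Compl[OF wo W_disj])
      show "\<And>\<mu> n. \<mu> \<in> Field \<eta> \<Longrightarrow> W \<mu> n \<subseteq> topspace Z" using W openin_subset by fast
    qed
    moreover have "topspace Z - C\<^sub>0 - (\<Union>\<mu>\<in>Field \<eta>. \<Union>k. W \<mu> k) = F - C\<^sub>0"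
      unfolding F_def by blast
    moreover have "D\<^sub>0 - (\<Union>\<mu>\<in>Field \<eta>. \<Union>k. W \<mu> k) = D\<^sub>0 \<inter> F"
      unfolding F_def using C\<^sub>0(2) G_sub by blast
    moreover have "F - C\<^sub>0 = D\<^sub>0 \<inter> F" using C\<^sub>0(3) by blast
    ultimately show ?thesis unfolding sep_diff_def by simp
  qed
  then have "?C = topspace Z - ?D" using sub(1) by blast
  moreover have "?C \<in> SD Z \<eta> \<D> \<Gamma>\<^sub>0"
    using W W_disj E C\<^sub>0(1) by (rule sep_diff_in_SD)
  moreover have "?D \<in> SD Z \<eta> \<D> \<Gamma>\<^sub>0"
    using E D_compl by (intro sep_diff_in_SD[OF W W_disj _ C\<^sub>0(2)]) blast
  ultimately have "?C \<in> Delta_class Z (SD Z \<eta> \<D> \<Gamma>\<^sub>0)"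
    unfolding Delta_class_def dual_class_def by blast
  moreover have C_sep: "(x \<in> S \<longrightarrow> x \<in> ?C) \<and> (x \<in> ?C \<longrightarrow> x \<notin> T)" if x: "x \<in> topspace Z" for x
  proof (rule enters_at_cases[OF wo, of x W])
    fix \<mu> k assume "enters_at \<eta> W x \<mu> k"
    then show ?thesis using E_sep sep_diff_at_entry[OF wo W_disj] by blast
  next
    assume out: "\<And>\<mu> k. \<mu> \<in> Field \<eta> \<Longrightarrow> x \<notin> W \<mu> k"
    then have "x \<in> F" using F_iff[OF x] by blast
    then show ?thesis
      using S_F[of x] T_F[of x] sep_diff_outside[of \<eta> x W E C\<^sub>0] out C\<^sub>0 by blast
  qed
  moreover have "S \<subseteq> ?C" "?C \<subseteq> topspace Z - T" using C_sep sub by blast+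
  ultimately show "\<exists>C\<in>Delta_class Z (SD Z \<eta> \<D> \<Gamma>\<^sub>0). S \<subseteq> C \<and> C \<subseteq> topspace Z - T"
    by blast
qed

lemma Wadge_class_subset_Pow: "Wadge_class Z \<Gamma> \<Longrightarrow> \<Gamma> \<subseteq> Pow (topspace Z)"
  unfolding Wadge_class_def by blast

lemma Wadge_class_preimage:
  assumes "Wadge_class Z \<Gamma>" "continuous_map Z Z f" "S \<in> \<Gamma>"
  shows "f -` S \<inter> topspace Z \<in> \<Gamma>"
proof -
  obtain A where \<Gamma>: "\<Gamma> = {g -` A \<inter> topspace Z | g. continuous_map Z Z g}"
    using assms(1) unfolding Wadge_class_def by blast
  then obtain g where g: "continuous_map Z Z g" "S = g -` A \<inter> topspace Z" using assms(3) by blast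
  have "f -` S \<inter> topspace Z = (g \<circ> f) -` A \<inter> topspace Z"
    using g(2) continuous_map_image_subset_topspace[OF assms(2)] by auto
  then show ?thesis using \<Gamma> continuous_map_compose[OF assms(2) g(1)] by blast
qed

theorem theorem5p18:
  fixes \<Sigma> :: pointclass
    and Z :: "'a topology"
    and \<eta> :: "'i rel"
    and \<Lambda> :: "nat \<Rightarrow> 'a set set"
    and \<Gamma>\<^sub>0 \<D> \<Gamma> :: "'a set set"
  assumes "nice_pointclass \<Sigma>"
    and "Det (\<Sigma> Baire_space)"
    and "Polish_space Z" and "zero_dimensional Z" and "uncountable (topspace Z)"
    and "Well_order \<eta>" and "countable (Field \<eta>)" and "Field \<eta> \<noteq> {}"
    and "\<And>n. \<Lambda> n \<in> NSD Z" and "\<And>n. level_ge_1 Z (\<Lambda> n)"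
    and "\<D> = (\<Union>n. \<Lambda> n \<union> dual_class Z (\<Lambda> n))"
    and "\<Gamma>\<^sub>0 \<in> NSD Z" and "\<Gamma>\<^sub>0 \<subseteq> \<D>"
    and "\<Gamma> = SD Z \<eta> \<D> \<Gamma>\<^sub>0"
    and "\<Gamma> \<subseteq> pc_at \<Sigma> Z"
    and "separation_property Z \<Gamma>\<^sub>0"
  shows "separation_property Z \<Gamma>"
proof -
  have Z: "sm_space Z"
    using assms(3) completely_metrizable_imp_metrizable_space
    unfolding Polish_space_def sm_space_def by blast
  have W: "Wadge_class Z (\<Lambda> n)" "Wadge_class Z \<Gamma>\<^sub>0" for n
    using assms(9)[of n] assms(12) unfolding NSD_def by blast+
  have D_sub: "\<D> \<subseteq> Pow (topspace Z)"
    using Wadge_class_subset_Pow[OF W(1)] unfolding assms(11) dual_class_def by blast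
  have D_compl: "topspace Z - S \<in> \<D>" if S: "S \<in> \<D>" for S
  proof -
    obtain n where "S \<in> \<Lambda> n \<or> S \<in> dual_class Z (\<Lambda> n)" using S assms(11) by blast
    then have "topspace Z - S \<in> \<Lambda> n \<union> dual_class Z (\<Lambda> n)"
    proof
      assume "S \<in> dual_class Z (\<Lambda> n)"
      then obtain L where L: "L \<in> \<Lambda> n" "S = topspace Z - L" unfolding dual_class_def by blast
      then have "topspace Z - S = L" using Wadge_class_subset_Pow[OF W(1)] by blast
      then show ?thesis using L by simp
    qed (auto simp: dual_class_def)
    then show ?thesis using assms(11) by blast
  qed
  show ?thesis
    unfolding assms(14)
    by (rule separation_property_SD[OF Z assms(4,6) D_sub D_compl
          Wadge_class_subset_Pow[OF W(2)] Wadge_class_preimage[OF W(2)] assms(16)])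
qed

end
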